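(* Let $A,B\in\mathbb{H}^{n\times n}$ be similar matrices, i.e. $B=S^{-1}AS$ for some invertible $S\in\mathbb{H}^{n\times n}$. Then $A$ and $B$ have the same right spectrum (set of right eigenvalues), and for every right eigenvalue $q$ of $A$ and $B$, $$a.m.(q,A)=a.m.(q,B)\quad\text{and}\quad g.m.(q,A)=g.m.(q,B).$$
   Context: $\mathbb{H}$ is the algebra of real quaternions with units $i,j,k$, and $\mathbb{C}=\{a+bi: a,b\in\mathbb{R}\}\subset\mathbb{H}$. Two quaternions $q_1,q_2$ are similar if $q_1=h^{-1}q_2h$ for some nonzero $h\in\mathbb{H}$; $[q]$ denotes the similarity class of $q$. It is known that each class $[q]$ contains a unique complex number $\lambda_q$ with $\mathrm{Im}(\lambda_q)\ge0$. $\mathbb{H}^n$ is the space of column vectors of length $n$ with entries in $\mathbb{H}$, regarded as a right $\mathbb{H}$-vector space. A quaternion $q$ is a right eigenvalue of $A\in\mathbb{H}^{n\times n}$ if there is a nonzero $x\in\mathbb{H}^n$ with $Ax=xq$. $A^*$ is the conjugate transpose; $U$ is unitary if $U^*U=UU^*=Id$. Algebraic multiplicity: it is known that there are $U,T\in\mathbb{H}^{n\times n}$ with $U$ unitary, $T$ upper triangular, $T=U^*AU$, and all diagonal entries of $T$ complex numbers with nonnegative imaginary part. For a right eigenvalue $q$ of $A$, $a.m.(q,A)$ is the number of occurrences of $\lambda_q$ on the diagonal of such a $T$ (this number does not depend on the choice of $U,T$). Geometric multiplicity: for $\tilde q\in\mathbb{H}$ put $V_{\tilde q}=\{x\in\mathbb{H}^n: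 Ax=x\tilde q\}$. The $[q]$-eigenspace is $V_{[q]}:=\sum_{\tilde q\in[q]}V_{\tilde q}$, the set of all finite sums of vectors each lying in some $V_{\tilde q}$ with $\tilde q\in[q]$; it is a right $\mathbb{H}$-vector subspace of $\mathbb{H}^n$. Then $g.m.(q,A):=\dim_{\mathbb{H}}V_{[q]}$, the dimension as a right $\mathbb{H}$-vector space. *)

theory Defs
  imports Complex_Main "Jordan_Normal_Form.Matrix"
begin

text \<open>\<open>Quat a b c d\<close> is the real quaternion \<open>a + b i + c j + d k\<close>.\<close>

datatype quat = Quat (qre: real) (qim1: real) (qim2: real) (qim3: real)

instantiation quat :: ring_1
begin

definition "0 = Quat 0 0 0 0"

definition "1 = Quat 1 0 0 0"

definition "p + q = Quat (qre p + qre q) (qim1 p + qim1 q) (qim2 p + qim2 q) (qim3 p + qim3 q)"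

definition "- p = Quat (- qre p) (- qim1 p) (- qim2 p) (- qim3 p)"

definition "p - q = Quat (qre p - qre q) (qim1 p - qim1 q) (qim2 p - qim2 q) (qim3 p - qim3 q)"

definition
  "p * q = Quat
    (qre p * qre q - qim1 p * qim1 q - qim2 p * qim2 q - qim3 p * qim3 q)
    (qre p * qim1 q + qim1 p * qre q + qim2 p * qim3 q - qim3 p * qim2 q)
    (qre p * qim2 q - qim1 p * qim3 q + qim2 p * qre q + qim3 p * qim1 q)
    (qre p * qim3 q + qim1 p * qim2 q - qim2 p * qim1 q + qim3 p * qre q)"

instance
  by standard
    (simp_all add: zero_quat_def one_quat_def plus_quat_def uminus_quat_def minus_quat_def
      times_quat_def algebra_simps)

end

instantiation quat :: conjugate
begin

definition "conjugate p = Quat (qre p) (- qim1 p) (- qim2 p) (- qim3 p)"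

instance
  by standard (auto simp: conjugate_quat_def intro: quat.expand)

end

definition quat_normsq :: "quat \<Rightarrow> real" where
  "quat_normsq p = (qre p)\<^sup>2 + (qim1 p)\<^sup>2 + (qim2 p)\<^sup>2 + (qim3 p)\<^sup>2"

lemma quat_normsq_eq_0_iff: "quat_normsq p = 0 \<longleftrightarrow> p = 0"
  by (cases p) (auto simp: quat_normsq_def zero_quat_def add_nonneg_eq_0_iff)

instantiation quat :: division_ring
begin

definition
  "inverse p = Quat (qre p / quat_normsq p) (- qim1 p / quat_normsq p)
    (- qim2 p / quat_normsq p) (- qim3 p / quat_normsq p)"

definition "p div q = p * inverse q" for p q :: quat

instance
proof
  fix p q :: quat
  show "inverse p * p = 1" "p * inverse p = 1" if "p \<noteq> 0"
  proof -
    have "quat_normsq p \<noteq> 0"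
      using that by (simp add: quat_normsq_eq_0_iff)
    moreover have
      "qre p * qre p + qim1 p * qim1 p + qim2 p * qim2 p + qim3 p * qim3 p = quat_normsq p"
      by (simp add: quat_normsq_def power2_eq_square)
    ultimately show "inverse p * p = 1" "p * inverse p = 1"
      by (simp_all add: times_quat_def inverse_quat_def one_quat_def mult.commute
          flip: add_divide_distrib diff_divide_distrib)
  qed
  show "p div q = p * inverse q"
    by (rule divide_quat_def)
  show "inverse (0 :: quat) = 0"
    by (simp add: inverse_quat_def zero_quat_def)
qed

end

definition complex_quats :: "quat set" where
  "complex_quats = {Quat a b 0 0 | a b. True}"

definition quat_similar :: "quat \<Rightarrow> quat \<Rightarrow> bool" where
  "quat_similar p q \<longleftrightarrow> (\<exists>h. h \<noteq> 0 \<and> p = inverse h * q * h)"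

definition similarity_class :: "quat \<Rightarrow> quat set" where
  "similarity_class q = {p. quat_similar p q}"

definition complex_rep :: "quat \<Rightarrow> quat" where
  "complex_rep q = (THE l. l \<in> similarity_class q \<and> l \<in> complex_quats \<and> qim1 l \<ge> 0)"

text \<open>
  The library's scalar multiplication of vectors acts on the left; over the quaternions the
  right action is a different operation.
\<close>

definition right_smult_vec :: "quat vec \<Rightarrow> quat \<Rightarrow> quat vec" (infixl \<open>\<cdot>\<^sub>r\<close> 70) where
  "v \<cdot>\<^sub>r q = map_vec (\<lambda>a. a * q) v"

definition right_eigenspace :: "quat mat \<Rightarrow> quat \<Rightarrow> quat vec set" where
  "right_eigenspace A q = {x \<in> carrier_vec (dim_row A). A *\<^sub>v x = x \<cdot>\<^sub>r q}"

definition right_eigenvalue :: "quat mat \<Rightarrow> quat \<Rightarrow> bool" where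
  "right_eigenvalue A q \<longleftrightarrow>
    (\<exists>x \<in> carrier_vec (dim_row A). x \<noteq> 0\<^sub>v (dim_row A) \<and> A *\<^sub>v x = x \<cdot>\<^sub>r q)"

definition right_spectrum :: "quat mat \<Rightarrow> quat set" where
  "right_spectrum A = {q. right_eigenvalue A q}"

text \<open>
  The library's \<open>mat_adjoint\<close> needs conjugation to be multiplicative, whereas quaternion
  conjugation reverses products.
\<close>

definition conj_transpose :: "quat mat \<Rightarrow> quat mat" where
  "conj_transpose A = map_mat conjugate (transpose_mat A)"

definition quat_unitary :: "nat \<Rightarrow> quat mat \<Rightarrow> bool" where
  "quat_unitary n U \<longleftrightarrow>
    U \<in> carrier_mat n n \<and> conj_transpose U * U = 1\<^sub>m n \<and> U * conj_transpose U = 1\<^sub>m n"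

definition schur_form :: "quat mat \<Rightarrow> quat mat \<Rightarrow> quat mat \<Rightarrow> bool" where
  "schur_form A U T \<longleftrightarrow>
    quat_unitary (dim_row A) U \<and> upper_triangular T \<and> T = conj_transpose U * A * U \<and>
    (\<forall>i < dim_row T. T $$ (i, i) \<in> complex_quats \<and> qim1 (T $$ (i, i)) \<ge> 0)"

text \<open>A Schur form always exists, and the count below is the same for all of them.\<close>

definition alg_mult :: "quat \<Rightarrow> quat mat \<Rightarrow> nat" where
  "alg_mult q A = (THE m. \<exists>U T. schur_form A U T \<and> m = count_list (diag_mat T) (complex_rep q))"

definition class_eigenspace :: "quat mat \<Rightarrow> quat \<Rightarrow> quat vec set" where
  "class_eigenspace A q =
    {finsum_vec TYPE(quat) (dim_row A) v {..<m} | (m :: nat) v.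
      \<forall>k < m. \<exists>p \<in> similarity_class q. v k \<in> right_eigenspace A p}"

text \<open>
  The library's vector spaces and modules have commutative scalars, so bases of right
  \<open>quat\<close>-subspaces of \<open>carrier_vec n\<close> are introduced here.
\<close>

definition right_lincomb :: "nat \<Rightarrow> (quat vec \<Rightarrow> quat) \<Rightarrow> quat vec set \<Rightarrow> quat vec" where
  "right_lincomb n c W = finsum_vec TYPE(quat) n (\<lambda>w. w \<cdot>\<^sub>r c w) W"

definition right_basis :: "nat \<Rightarrow> quat vec set \<Rightarrow> quat vec set \<Rightarrow> bool" where
  "right_basis n V W \<longleftrightarrow>
    finite W \<and> W \<subseteq> V \<and>
    (\<forall>c. right_lincomb n c W = 0\<^sub>v n \<longrightarrow> (\<forall>w \<in> W. c w = 0)) \<and>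
    (\<forall>v \<in> V. \<exists>c. v = right_lincomb n c W)"

definition right_dim :: "nat \<Rightarrow> quat vec set \<Rightarrow> nat" where
  "right_dim n V = (THE d. \<exists>W. right_basis n V W \<and> d = card W)"

definition geom_mult :: "quat \<Rightarrow> quat mat \<Rightarrow> nat" where
  "geom_mult q A = right_dim (dim_row A) (class_eigenspace A q)"

end

theory Submission
  imports Defs "Jordan_Normal_Form.Spectral_Radius"
begin

text \<open>
  Replacing each quaternion entry by a \<open>2 \<times> 2\<close> complex block is multiplicative, so similar
  quaternionic matrices have complex images with the same characteristic polynomial. The image of a
  Schur form is upper triangular, with \<open>\<lambda>\<close> and \<open>cnj \<lambda>\<close> on the diagonal for each diagonal
  entry \<open>\<lambda>\<close>; since \<open>Im \<lambda> \<ge> 0\<close>, root orders determine the number of occurrences of \<open>\<lambda>\<close>.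
  Schur forms exist by induction: an eigenvector of the complex image gives a right eigenvector with
  complex eigenvalue, which a Householder reflection moves to the first axis. For the spectrum and
  the geometric multiplicity, \<open>x \<mapsto> S\<^sup>-\<^sup>1 x\<close> carries the eigenspaces of \<open>A\<close> to those of \<open>B\<close>.
\<close>

section \<open>Quaternion arithmetic: conjugation, real scalars and the norm\<close>

lemma quat_eq_iff: "p = q \<longleftrightarrow> qre p = qre q \<and> qim1 p = qim1 q \<and> qim2 p = qim2 q \<and> qim3 p = qim3 q"
  by (cases p; cases q) simp

lemmas quat_ops = zero_quat_def one_quat_def plus_quat_def uminus_quat_def minus_quat_def
  times_quat_def conjugate_quat_def

lemma conjugate_quat_add: "conjugate (p + q) = conjugate p + conjugate (q :: quat)"
  and conjugate_quat_diff: "conjugate (p - q) = conjugate p - conjugate (q :: quat)"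
  and conjugate_quat_mult: "conjugate (p * q) = conjugate q * conjugate (p :: quat)"
  and conjugate_quat_0 [simp]: "conjugate (0 :: quat) = 0"
  and conjugate_quat_1 [simp]: "conjugate (1 :: quat) = 1"
  by (simp_all add: quat_ops algebra_simps)

lemma conjugate_quat_sum: "conjugate (sum f X) = (\<Sum>x\<in>X. conjugate (f x :: quat))"
  by (induct X rule: infinite_finite_induct) (auto simp: conjugate_quat_add)

text \<open>The embedding of the reals as the centre of the quaternions. Norms and inner products
  that turn out to be real are written this way so that they can be moved through noncommutative
  products.\<close>

definition quat_real :: "real \<Rightarrow> quat" where
  "quat_real r = Quat r 0 0 0"

lemma quat_real_0 [simp]: "quat_real 0 = 0"
  and quat_real_1 [simp]: "quat_real 1 = 1"
  and quat_real_mult: "quat_real (r * s) = quat_real r * quat_real s"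
  and quat_real_add: "quat_real (r + s) = quat_real r + quat_real s"
  and quat_real_diff: "quat_real (r - s) = quat_real r - quat_real s"
  and conjugate_quat_real [simp]: "conjugate (quat_real r) = quat_real r"
  and quat_real_commute: "quat_real r * p = p * quat_real r"
  by (simp_all add: quat_real_def quat_ops algebra_simps)

lemma quat_real_eq_0_iff [simp]: "quat_real r = 0 \<longleftrightarrow> r = 0"
  by (simp add: quat_real_def quat_ops)

lemma quat_real_sum: "quat_real (sum f X) = (\<Sum>x\<in>X. quat_real (f x))"
  by (induct X rule: infinite_finite_induct) (auto simp: quat_real_add)

lemma conjugate_mult_self: "conjugate p * p = quat_real (quat_normsq p)"
  by (simp add: quat_real_def quat_ops quat_normsq_def power2_eq_square)

lemma quat_normsq_nonneg: "quat_normsq p \<ge> 0"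
  by (simp add: quat_normsq_def)

section \<open>Right multiplication and conjugate transposes\<close>

lemma right_smult_vec_carrier [simp]: "x \<cdot>\<^sub>r q \<in> carrier_vec n \<longleftrightarrow> x \<in> carrier_vec n"
  unfolding carrier_vec_def by (simp add: right_smult_vec_def)

lemma dim_right_smult_vec [simp]: "dim_vec (x \<cdot>\<^sub>r q) = dim_vec x"
  by (simp add: right_smult_vec_def)

lemma index_right_smult_vec [simp]: "i < dim_vec x \<Longrightarrow> (x \<cdot>\<^sub>r q) $ i = x $ i * q"
  by (simp add: right_smult_vec_def)

lemma right_smult_vec_assoc: "x \<cdot>\<^sub>r p \<cdot>\<^sub>r q = x \<cdot>\<^sub>r (p * q)"
  by (rule eq_vecI) (auto simp: mult.assoc)

lemma right_smult_vec_1 [simp]: "x \<cdot>\<^sub>r 1 = x"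
  by (rule eq_vecI) auto

text \<open>The matrix acts from the left and the scalar from the right, so associativity of the
  quaternion product makes every matrix a right-linear map.\<close>

lemma mult_mat_vec_right_smult:
  assumes "A \<in> carrier_mat m n" "x \<in> carrier_vec n"
  shows "A *\<^sub>v (x \<cdot>\<^sub>r q) = (A *\<^sub>v x) \<cdot>\<^sub>r q"
  using assms by (intro eq_vecI) (auto simp: scalar_prod_def sum_distrib_right mult.assoc)

lemma right_smult_vec_eq_0_iff:
  assumes "q \<noteq> 0" "x \<in> carrier_vec n"
  shows "x \<cdot>\<^sub>r q = 0\<^sub>v n \<longleftrightarrow> x = 0\<^sub>v n"
proof
  assume "x \<cdot>\<^sub>r q = 0\<^sub>v n"
  then have "x \<cdot>\<^sub>r q \<cdot>\<^sub>r inverse q = 0\<^sub>v n \<cdot>\<^sub>r inverse q" by simp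
  also have "\<dots> = 0\<^sub>v n" by (rule eq_vecI) auto
  finally show "x = 0\<^sub>v n" using assms by (simp add: right_smult_vec_assoc)
next
  assume "x = 0\<^sub>v n"
  then show "x \<cdot>\<^sub>r q = 0\<^sub>v n" by (intro eq_vecI) auto
qed

lemma conj_transpose_carrier [simp]:
  "conj_transpose A \<in> carrier_mat m n \<longleftrightarrow> A \<in> carrier_mat n m"
  by (auto simp: conj_transpose_def)

lemma dim_conj_transpose [simp]:
  "dim_row (conj_transpose A) = dim_col A" "dim_col (conj_transpose A) = dim_row A"
  by (simp_all add: conj_transpose_def)

lemma index_conj_transpose [simp]:
  "i < dim_col A \<Longrightarrow> j < dim_row A \<Longrightarrow> conj_transpose A $$ (i, j) = conjugate (A $$ (j, i))"
  by (simp add: conj_transpose_def)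

lemma conj_transpose_mult:
  assumes "A \<in> carrier_mat l m" "B \<in> carrier_mat m n"
  shows "conj_transpose (A * B) = conj_transpose B * conj_transpose A"
  using assms
  by (intro eq_matI) (auto simp: scalar_prod_def conjugate_quat_sum conjugate_quat_mult)

lemma conj_transpose_four_block:
  assumes "A \<in> carrier_mat nr1 nc1" "B \<in> carrier_mat nr1 nc2"
    "C \<in> carrier_mat nr2 nc1" "D \<in> carrier_mat nr2 nc2"
  shows "conj_transpose (four_block_mat A B C D) =
    four_block_mat (conj_transpose A) (conj_transpose C) (conj_transpose B) (conj_transpose D)"
  using assms by (intro eq_matI) auto

lemma conj_transpose_one [simp]: "conj_transpose (1\<^sub>m n) = 1\<^sub>m n"
  by (rule eq_matI) auto

lemma conj_transpose_zero [simp]: "conj_transpose (0\<^sub>m m n) = 0\<^sub>m n m"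
  by (rule eq_matI) auto

lemma quat_unitary_one: "quat_unitary n (1\<^sub>m n)"
  by (simp add: quat_unitary_def)

lemma quat_unitary_mult:
  assumes "quat_unitary n U" "quat_unitary n V"
  shows "quat_unitary n (U * V)"
proof -
  have c: "U \<in> carrier_mat n n" "V \<in> carrier_mat n n"
    "conj_transpose U \<in> carrier_mat n n" "conj_transpose V \<in> carrier_mat n n"
    and u: "conj_transpose U * U = 1\<^sub>m n" "U * conj_transpose U = 1\<^sub>m n"
    "conj_transpose V * V = 1\<^sub>m n" "V * conj_transpose V = 1\<^sub>m n"
    using assms by (auto simp: quat_unitary_def)
  have "conj_transpose V * conj_transpose U * (U * V) = 1\<^sub>m n"
  proof -
    have "conj_transpose V * conj_transpose U * (U * V)
        = conj_transpose V * (conj_transpose U * (U * V))"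
      by (rule assoc_mult_mat[of _ n n _ n _ n]) (use c in auto)
    also have "conj_transpose U * (U * V) = conj_transpose U * U * V"
      by (rule assoc_mult_mat[of _ n n _ n _ n, symmetric]) (use c in auto)
    finally show ?thesis using c u by simp
  qed
  moreover have "U * V * (conj_transpose V * conj_transpose U) = 1\<^sub>m n"
  proof -
    have "U * V * (conj_transpose V * conj_transpose U)
        = U * (V * (conj_transpose V * conj_transpose U))"
      by (rule assoc_mult_mat[of _ n n _ n _ n]) (use c in auto)
    also have "V * (conj_transpose V * conj_transpose U) = V * conj_transpose V * conj_transpose U"
      by (rule assoc_mult_mat[of _ n n _ n _ n, symmetric]) (use c in auto)
    finally show ?thesis using c u by simp
  qed
  ultimately show ?thesis
    unfolding quat_unitary_def conj_transpose_mult[OF c(1,2)] using c by auto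
qed

section \<open>The complex representation\<close>

text \<open>Writing a quaternion as \<open>z + w j\<close> with complex \<open>z\<close>, \<open>w\<close>, these are the entries of the
  matrix with rows \<open>(z, w)\<close> and \<open>(- cnj w, cnj z)\<close>.\<close>

definition quat_entry :: "quat \<Rightarrow> nat \<Rightarrow> nat \<Rightarrow> complex" where
  "quat_entry q r s =
    (if r = 0 then if s = 0 then Complex (qre q) (qim1 q) else Complex (qim2 q) (qim3 q)
     else if s = 0 then Complex (- qim2 q) (qim3 q) else Complex (qre q) (- qim1 q))"

text \<open>The \<open>2 \<times> 2\<close> blocks are interleaved so that upper triangular matrices with complex diagonal
  stay upper triangular.\<close>

definition complex_mat :: "quat mat \<Rightarrow> complex mat" where
  "complex_mat A = mat (2 * dim_row A) (2 * dim_col A)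
    (\<lambda>(r, s). quat_entry (A $$ (r div 2, s div 2)) (r mod 2) (s mod 2))"

text \<open>Only the first column of each block is kept: it already determines the quaternion, and
  right multiplication by a complex number merely scales it.\<close>

definition complex_vec :: "quat vec \<Rightarrow> complex vec" where
  "complex_vec x = vec (2 * dim_vec x) (\<lambda>r. quat_entry (x $ (r div 2)) (r mod 2) 0)"

lemma quat_entry_add: "quat_entry (p + q) r s = quat_entry p r s + quat_entry q r s"
  by (simp add: quat_entry_def quat_ops complex_eq_iff)

lemma quat_entry_0 [simp]: "quat_entry 0 r s = 0"
  by (simp add: quat_entry_def quat_ops complex_eq_iff)

lemma quat_entry_sum: "quat_entry (sum f X) r s = (\<Sum>x\<in>X. quat_entry (f x) r s)"
  by (induct X rule: infinite_finite_induct) (auto simp: quat_entry_add)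

text \<open>This is the rule \<open>j z = cnj z j\<close>: the product of \<open>z + w j\<close> and
  \<open>z' + w' j\<close> is \<open>(z z' - w cnj w') + (z w' + w cnj z') j\<close>.\<close>

lemma quat_entry_mult:
  "quat_entry (p * q) r s = quat_entry p r 0 * quat_entry q 0 s + quat_entry p r 1 * quat_entry q 1 s"
  by (simp add: quat_entry_def quat_ops complex_eq_iff algebra_simps)

text \<open>Splits a sum over interleaved indices into the two positions inside each block, which
  reduces products of represented matrices to \<open>quat_entry_mult\<close>.\<close>

lemma sum_pairs: "(\<Sum>k = 0..<2 * n. f k) = (\<Sum>k = 0..<n. f (2 * k) + f (2 * k + 1 :: nat))"
  by (induct n) (auto simp: add_ac)

lemma complex_mat_carrier [simp]:
  "A \<in> carrier_mat m n \<Longrightarrow> complex_mat A \<in> carrier_mat (2 * m) (2 * n)"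
  by (auto simp: complex_mat_def)

lemma complex_mat_one [simp]: "complex_mat (1\<^sub>m n) = 1\<^sub>m (2 * n)"
proof (rule eq_matI)
  fix i j assume "i < dim_row (1\<^sub>m (2 * n) :: complex mat)" "j < dim_col (1\<^sub>m (2 * n) :: complex mat)"
  then have ij: "i < 2 * n" "j < 2 * n" by auto
  moreover have "i = j \<longleftrightarrow> i div 2 = j div 2 \<and> i mod 2 = j mod 2"
    by (metis div_mult_mod_eq)
  moreover have "i mod 2 < 2" "j mod 2 < 2" by auto
  ultimately show "complex_mat (1\<^sub>m n) $$ (i, j) = 1\<^sub>m (2 * n) $$ (i, j)"
    by (auto simp: complex_mat_def quat_entry_def one_quat_def zero_quat_def complex_eq_iff
        less_mult_imp_div_less mult.commute)
qed (auto simp: complex_mat_def)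

lemma complex_mat_mult:
  assumes "A \<in> carrier_mat l m" "B \<in> carrier_mat m n"
  shows "complex_mat (A * B) = complex_mat A * complex_mat B"
proof (rule eq_matI)
  fix i j assume "i < dim_row (complex_mat A * complex_mat B)" "j < dim_col (complex_mat A * complex_mat B)"
  then have ij: "i < 2 * l" "j < 2 * n" "i div 2 < l" "j div 2 < n"
    using assms by (auto simp: complex_mat_def)
  then show "complex_mat (A * B) $$ (i, j) = (complex_mat A * complex_mat B) $$ (i, j)"
    using assms by (simp add: complex_mat_def scalar_prod_def sum_pairs quat_entry_sum quat_entry_mult)
qed (use assms in \<open>auto simp: complex_mat_def\<close>)

lemma complex_vec_carrier [simp]:
  "x \<in> carrier_vec n \<Longrightarrow> complex_vec x \<in> carrier_vec (2 * n)"
  by (auto simp: complex_vec_def)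

lemma complex_vec_mult:
  assumes "A \<in> carrier_mat m n" "x \<in> carrier_vec n"
  shows "complex_vec (A *\<^sub>v x) = complex_mat A *\<^sub>v complex_vec x"
proof (rule eq_vecI)
  fix i assume "i < dim_vec (complex_mat A *\<^sub>v complex_vec x)"
  then have i: "i < 2 * m" "i div 2 < m"
    using assms by (auto simp: complex_mat_def)
  then show "complex_vec (A *\<^sub>v x) $ i = (complex_mat A *\<^sub>v complex_vec x) $ i"
    using assms
    by (simp add: complex_mat_def complex_vec_def scalar_prod_def sum_pairs quat_entry_sum
        quat_entry_mult)
qed (use assms in \<open>auto simp: complex_mat_def complex_vec_def\<close>)

text \<open>A complex quaternion has a diagonal block with entries \<open>z\<close> and
  \<open>cnj z\<close>. Multiplying by it on the right scales the first column of a block by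
  \<open>z\<close>, and no other column is recorded.\<close>

lemma complex_vec_right_smult:
  "complex_vec (x \<cdot>\<^sub>r Quat (Re z) (Im z) 0 0) = z \<cdot>\<^sub>v complex_vec x"
proof (rule eq_vecI)
  fix i assume "i < dim_vec (z \<cdot>\<^sub>v complex_vec x)"
  then have "i < 2 * dim_vec x" "i div 2 < dim_vec x"
    by (auto simp: complex_vec_def)
  then show "complex_vec (x \<cdot>\<^sub>r Quat (Re z) (Im z) 0 0) $ i = (z \<cdot>\<^sub>v complex_vec x) $ i"
    by (simp add: complex_vec_def quat_entry_mult) (simp add: quat_entry_def complex_eq_iff)
qed (auto simp: complex_vec_def)

lemma complex_vec_inj:
  assumes "complex_vec x = complex_vec y" "x \<in> carrier_vec n" "y \<in> carrier_vec n"
  shows "x = y"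
proof (rule eq_vecI)
  fix i assume "i < dim_vec y"
  then have i: "i < n" using assms by auto
  have "complex_vec x $ (2 * i) = complex_vec y $ (2 * i)"
    "complex_vec x $ (2 * i + 1) = complex_vec y $ (2 * i + 1)"
    using assms by auto
  then show "x $ i = y $ i"
    using i assms(2,3) by (auto simp: complex_vec_def quat_entry_def quat_eq_iff)
qed (use assms in auto)

lemma complex_vec_surj:
  assumes "y \<in> carrier_vec (2 * n)"
  obtains x where "x \<in> carrier_vec n" "complex_vec x = y"
proof
  \<comment> \<open>A first column is \<open>(z, - cnj w)\<close>, so recovering \<open>w\<close>
    from the second entry negates the real part and keeps the imaginary part.\<close>
  let ?x = "vec n (\<lambda>i. Quat (Re (y $ (2 * i))) (Im (y $ (2 * i)))
    (- Re (y $ (2 * i + 1))) (Im (y $ (2 * i + 1))))"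
  show "?x \<in> carrier_vec n" by simp
  show "complex_vec ?x = y"
  proof (rule eq_vecI)
    fix r assume "r < dim_vec y"
    then have "r < 2 * n" "r div 2 < n" using assms by auto
    moreover have "2 * (r div 2) = r" if "r mod 2 = 0" using that by presburger
    moreover have "Suc (2 * (r div 2)) = r" if "r mod 2 \<noteq> 0" using that by presburger
    ultimately show "complex_vec ?x $ r = y $ r"
      by (auto simp: complex_vec_def quat_entry_def complex_eq_iff)
  qed (use assms in \<open>auto simp: complex_vec_def\<close>)
qed

text \<open>The complex image has an eigenvector, which pulls back along the bijection
  \<open>complex_vec\<close> to a right eigenvector with the same complex eigenvalue. A negative
  imaginary part is repaired by passing to the conjugate eigenvalue.\<close>

lemma exists_right_eigenvector:
  assumes A: "A \<in> carrier_mat n n" and "n > 0"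
  obtains x l where "x \<in> carrier_vec n" "x \<noteq> 0\<^sub>v n" "A *\<^sub>v x = x \<cdot>\<^sub>r l"
    "l \<in> complex_quats" "qim1 l \<ge> 0"
proof -
  have "spectrum (complex_mat A) \<noteq> {}"
    using spectrum_non_empty[of "complex_mat A" "2 * n"] assms by simp
  then obtain z y where y: "y \<in> carrier_vec (2 * n)" "y \<noteq> 0\<^sub>v (2 * n)"
    "complex_mat A *\<^sub>v y = z \<cdot>\<^sub>v y"
    using A by (auto simp: spectrum_def eigenvalue_def eigenvector_def complex_mat_def)
  then obtain x where x: "x \<in> carrier_vec n" "complex_vec x = y"
    using complex_vec_surj by blast
  let ?l = "Quat (Re z) (Im z) 0 0"
  have x0: "x \<noteq> 0\<^sub>v n"
  proof
    assume "x = 0\<^sub>v n"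
    then have "complex_vec x = 0\<^sub>v (2 * n)"
      by (intro eq_vecI) (auto simp: complex_vec_def)
    then show False using x y by simp
  qed
  have "complex_vec (A *\<^sub>v x) = complex_vec (x \<cdot>\<^sub>r ?l)"
    using x y A by (simp add: complex_vec_mult complex_vec_right_smult)
  then have ev: "A *\<^sub>v x = x \<cdot>\<^sub>r ?l"
    by (rule complex_vec_inj[where n = n]) (use x A in auto)
  show thesis
  proof (cases "Im z \<ge> 0")
    case True
    then show thesis using that[OF x(1) x0 ev] by (auto simp: complex_quats_def)
  next
    case False
    \<comment> \<open>Moving \<open>j\<close> past a complex number conjugates it, so
      \<open>x j\<close> is an eigenvector for the conjugate eigenvalue.\<close>
    let ?j = "Quat 0 0 1 0"
    have "?l * ?j = ?j * conjugate ?l" by (simp add: quat_ops)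
    then have "A *\<^sub>v (x \<cdot>\<^sub>r ?j) = x \<cdot>\<^sub>r ?j \<cdot>\<^sub>r conjugate ?l"
      using ev by (simp add: mult_mat_vec_right_smult[OF A x(1)] right_smult_vec_assoc)
    moreover have "x \<cdot>\<^sub>r ?j \<noteq> 0\<^sub>v n"
      using x0 x by (subst right_smult_vec_eq_0_iff) (auto simp: zero_quat_def)
    ultimately show thesis
      using that[of "x \<cdot>\<^sub>r ?j" "conjugate ?l"] x False
      by (auto simp: conjugate_quat_def complex_quats_def)
  qed
qed

section \<open>Invariance of the diagonal\<close>

lemma complex_mat_upper_triangular:
  assumes T: "T \<in> carrier_mat n n" "upper_triangular T"
    and d: "\<And>i. i < n \<Longrightarrow> T $$ (i, i) \<in> complex_quats"
  shows "upper_triangular (complex_mat T)"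
proof (rule upper_triangularI)
  fix i j assume ij: "j < i" "i < dim_row (complex_mat T)"
  then have i: "i div 2 < n" "j div 2 < n" "i < 2 * n" "j < 2 * n"
    using T by (auto simp: complex_mat_def)
  \<comment> \<open>A position below the diagonal lies in a block below the block diagonal, or is
    the lower left entry of a diagonal block. The latter vanishes because the diagonal quaternion is
    complex.\<close>
  have "j div 2 < i div 2 \<or> j div 2 = i div 2 \<and> i mod 2 = 1 \<and> j mod 2 = 0"
    using ij(1) by presburger
  then consider "j div 2 < i div 2" | "j div 2 = i div 2" "i mod 2 = 1" "j mod 2 = 0"
    by (elim disjE conjE)
  then show "complex_mat T $$ (i, j) = 0"
  proof cases
    case 1
    then have "T $$ (i div 2, j div 2) = 0" using T i by auto
    then show ?thesis using T i by (simp add: complex_mat_def)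
  next
    case 2
    then show ?thesis
      using T i d[of "i div 2"]
      by (auto simp: complex_mat_def complex_quats_def quat_entry_def complex_eq_iff)
  qed
qed

lemma count_list_map_pairs:
  "count_list (map f [0..<2 * n]) z =
    count_list (map (\<lambda>k. f (2 * k)) [0..<n]) z + count_list (map (\<lambda>k. f (2 * k + 1 :: nat)) [0..<n]) z"
  by (induct n) auto

text \<open>Each diagonal entry contributes itself and its conjugate. As all imaginary parts are
  nonnegative, the conjugate can match \<open>Complex a b\<close> only when \<open>b = 0\<close>,
  and then both copies match; this explains the factor 2.\<close>

lemma count_diag_complex_mat:
  assumes T: "T \<in> carrier_mat n n"
    and d: "\<And>i. i < n \<Longrightarrow> T $$ (i, i) \<in> complex_quats \<and> qim1 (T $$ (i, i)) \<ge> 0"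
    and b: "b \<ge> 0"
  shows "count_list (diag_mat (complex_mat T)) (Complex a b) =
    (if b = 0 then 2 else 1) * count_list (diag_mat T) (Quat a b 0 0)"
proof -
  have "diag_mat (complex_mat T) = map (\<lambda>r. quat_entry (T $$ (r div 2, r div 2)) (r mod 2) (r mod 2)) [0..<2 * n]"
    using T by (auto simp: diag_mat_def complex_mat_def)
  then have 1: "count_list (diag_mat (complex_mat T)) (Complex a b) =
      count_list (map (\<lambda>k. quat_entry (T $$ (k, k)) 0 0) [0..<n]) (Complex a b) +
      count_list (map (\<lambda>k. quat_entry (T $$ (k, k)) 1 1) [0..<n]) (Complex a b)"
    by (simp add: count_list_map_pairs)
  \<comment> \<open>Generalized from \<open>[0..<n]\<close> to any list of valid indices, so that
    list induction applies.\<close>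
  have "count_list (map (\<lambda>k. quat_entry (T $$ (k, k)) 0 0) ks) (Complex a b) +
      count_list (map (\<lambda>k. quat_entry (T $$ (k, k)) 1 1) ks) (Complex a b) =
    (if b = 0 then 2 else 1) * count_list (map (\<lambda>k. T $$ (k, k)) ks) (Quat a b 0 0)"
    if "set ks \<subseteq> {..<n}" for ks
    using that
  proof (induct ks)
    case (Cons k ks)
    then obtain c e where "T $$ (k, k) = Quat c e 0 0" "e \<ge> 0"
      using d[of k] by (auto simp: complex_quats_def)
    then show ?case using Cons b by (auto simp: quat_entry_def)
  qed simp
  from this[of "[0..<n]"] show ?thesis
    using T unfolding 1 by (auto simp: diag_mat_def lessThan_atLeast0)
qed

lemma count_diag_eq:
  assumes "T \<in> carrier_mat n n" "T' \<in> carrier_mat n n" and sim: "similar_mat T T'"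
    and "upper_triangular T" "upper_triangular T'"
    and d: "\<And>i. i < n \<Longrightarrow> T $$ (i, i) \<in> complex_quats \<and> qim1 (T $$ (i, i)) \<ge> 0"
    and d': "\<And>i. i < n \<Longrightarrow> T' $$ (i, i) \<in> complex_quats \<and> qim1 (T' $$ (i, i)) \<ge> 0"
  shows "count_list (diag_mat T) l = count_list (diag_mat T') l"
proof (cases "l \<in> complex_quats \<and> qim1 l \<ge> 0")
  case True
  then obtain a b where l: "l = Quat a b 0 0" "b \<ge> 0" by (auto simp: complex_quats_def)
  \<comment> \<open>The characteristic polynomial of a triangular matrix is the product of the
    linear factors of its diagonal entries, so root orders count those entries.\<close>
  have count: "count_list (diag_mat M) z = order z (char_poly M)"
    if "M \<in> carrier_mat k k" "upper_triangular M" for M :: "complex mat" and k z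
  proof -
    have "proots (\<Prod>a\<leftarrow>as. [:- a, 1:]) = mset as" for as :: "complex list"
    proof (induct as)
      case (Cons a as)
      have "(\<Prod>a\<leftarrow>as. [:- a, 1:]) \<noteq> 0" by (auto simp: prod_list_zero_iff)
      then show ?case
        using Cons proots_mult[of "[:- a, 1:]" "\<Prod>a\<leftarrow>as. [:- a, 1:]"] by simp
    qed simp
    then have "proots (char_poly M) = mset (diag_mat M)"
      by (simp add: char_poly_upper_triangular[OF that])
    moreover have "char_poly M \<noteq> 0"
      using degree_monic_char_poly[OF that(1)] by auto
    ultimately show ?thesis by (metis count_mset count_proots)
  qed
  obtain P Q k where PQ: "{T, T', P, Q} \<subseteq> carrier_mat k k"
    "P * Q = 1\<^sub>m k" "Q * P = 1\<^sub>m k" "T = P * T' * Q"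
    using similar_matD[OF sim] by blast
  have "similar_mat (complex_mat T) (complex_mat T')"
  proof (rule similar_matI)
    show "{complex_mat T, complex_mat T', complex_mat P, complex_mat Q} \<subseteq> carrier_mat (2 * k) (2 * k)"
      using PQ by auto
    show "complex_mat P * complex_mat Q = 1\<^sub>m (2 * k)" "complex_mat Q * complex_mat P = 1\<^sub>m (2 * k)"
      using PQ by (auto simp flip: complex_mat_mult[of _ k k _ k])
    show "complex_mat T = complex_mat P * complex_mat T' * complex_mat Q"
      using PQ by (auto simp flip: complex_mat_mult[of _ k k _ k])
  qed
  then have "char_poly (complex_mat T) = char_poly (complex_mat T')"
    by (rule char_poly_similar)
  then have "count_list (diag_mat (complex_mat T)) z = count_list (diag_mat (complex_mat T')) z" for z
    using assms by (simp add: count[of _ "2 * n"] complex_mat_upper_triangular[of _ n])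
  \<comment> \<open>Both sides carry the same factor 1 or 2, which cancels.\<close>
  from this[of "Complex a b"] show ?thesis
    using assms l by (simp add: count_diag_complex_mat[of _ n] split: if_splits)
next
  case False
  \<comment> \<open>Such an \<open>l\<close> violates the condition on diagonal entries, so both
    counts are 0.\<close>
  then have "l \<notin> set (diag_mat T)" "l \<notin> set (diag_mat T')"
    using assms by (auto simp: diag_mat_def)
  then show ?thesis by simp
qed

section \<open>Schur triangularization\<close>

text \<open>The reflection is \<open>1 - v (2 / v* v) v*\<close> with \<open>v = x - y\<close>; the product \<open>x* y\<close> has to be real
  for it to map \<open>x\<close> to \<open>y\<close>.\<close>

lemma exists_householder:
  assumes x: "x \<in> carrier_vec n" and y: "y \<in> carrier_vec n"
    and norms: "(\<Sum>k<n. conjugate (x $ k) * x $ k) = (\<Sum>k<n. conjugate (y $ k) * y $ k)"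
    and real: "(\<Sum>k<n. conjugate (x $ k) * y $ k) = quat_real r"
  obtains H where "quat_unitary n H" "conj_transpose H = H" "H *\<^sub>v x = y"
proof (cases "x = y")
  case True
  then show thesis using that[of "1\<^sub>m n"] x by (simp add: quat_unitary_one)
next
  case False
  define v where "v = (\<lambda>k. x $ k - y $ k)"
  define s where "s = (\<Sum>k<n. quat_normsq (v k))"
  define S where "S = (\<Sum>k<n. quat_normsq (x $ k))"
  have xx: "(\<Sum>k<n. conjugate (x $ k) * x $ k) = quat_real S"
    by (simp add: S_def conjugate_mult_self quat_real_sum)
  \<comment> \<open>The product \<open>y* x\<close> is the conjugate of \<open>x* y\<close>, hence
    the same real number \<open>r\<close>.\<close>
  have "(\<Sum>k<n. conjugate (y $ k) * x $ k) = conjugate (\<Sum>k<n. conjugate (x $ k) * y $ k)"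
    by (simp add: conjugate_quat_sum conjugate_quat_mult)
  then have yx: "(\<Sum>k<n. conjugate (y $ k) * x $ k) = quat_real r"
    by (simp add: real)
  have vv: "(\<Sum>k<n. conjugate (v k) * v k) = quat_real s"
    by (simp add: s_def conjugate_mult_self quat_real_sum)
  have vx: "(\<Sum>k<n. conjugate (v k) * x $ k) = quat_real (S - r)"
    using xx yx by (simp add: v_def conjugate_quat_diff left_diff_distrib sum_subtractf quat_real_diff)
  have vy: "(\<Sum>k<n. conjugate (v k) * y $ k) = quat_real (r - S)"
    using xx real norms
    by (simp add: v_def conjugate_quat_diff left_diff_distrib sum_subtractf quat_real_diff)
  \<comment> \<open>Expanding one factor gives \<open>v* v = v* x - v* y\<close>.\<close>
  have "quat_real s = quat_real (S - r) - quat_real (r - S)"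
    unfolding vv[symmetric] vx[symmetric] vy[symmetric]
    by (simp add: v_def right_diff_distrib sum_subtractf)
  then have s: "s = 2 * (S - r)"
    by (simp add: quat_real_def quat_ops)
  have "s \<noteq> 0"
  proof
    assume "s = 0"
    then have "\<forall>k<n. v k = 0"
      by (simp add: s_def sum_nonneg_eq_0_iff quat_normsq_nonneg quat_normsq_eq_0_iff)
    then have "x = y" using x y by (intro eq_vecI) (auto simp: v_def)
    then show False using False by simp
  qed
  define c where "c = quat_real (2 / s)"
  have c_comm: "p * c = c * p" for p by (simp add: c_def quat_real_commute)
  \<comment> \<open>This makes the reflection send \<open>x\<close> to
    \<open>x - v = y\<close>.\<close>
  have c_vx: "c * quat_real (S - r) = 1"
    using \<open>s \<noteq> 0\<close> s by (simp add: c_def flip: quat_real_mult)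
  \<comment> \<open>This makes the quadratic term of the squared reflection cancel its two linear
    terms.\<close>
  have c_s: "c * (c * quat_real s) = c + c"
    using \<open>s \<noteq> 0\<close> by (simp add: c_def flip: quat_real_mult quat_real_add)
  define H where "H = mat n n (\<lambda>(i, j). (if i = j then 1 else 0) - c * (v i * conjugate (v j)))"
  have H: "H \<in> carrier_mat n n" by (simp add: H_def)
  have herm: "conj_transpose H = H"
  proof (rule eq_matI)
    fix i j assume "i < dim_row H" "j < dim_col H"
    moreover have "conjugate (c * (v j * conjugate (v i))) = c * (v i * conjugate (v j))"
      using c_comm by (simp add: conjugate_quat_mult) (simp add: c_def)
    ultimately show "conj_transpose H $$ (i, j) = H $$ (i, j)"
      by (auto simp: H_def conjugate_quat_diff)
  qed (simp_all add: H_def)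
  have HH: "H * H = 1\<^sub>m n"
  proof (rule eq_matI)
    fix i j assume "i < dim_row (1\<^sub>m n :: quat mat)" "j < dim_col (1\<^sub>m n :: quat mat)"
    then have ij: "i < n" "j < n" by auto
    have entry: "H $$ (i, k) * H $$ (k, j) =
        (if k = i then if i = j then 1 else 0 else 0)
        - (if k = j then c * (v i * conjugate (v j)) else 0)
        - (if k = i then c * (v i * conjugate (v j)) else 0)
        + c * c * v i * (conjugate (v k) * v k) * conjugate (v j)" if "k < n" for k
    proof -
      have "c * (v i * conjugate (v k)) * (c * (v k * conjugate (v j)))
          = c * c * v i * (conjugate (v k) * v k) * conjugate (v j)"
        by (metis c_comm mult.assoc)
      then show ?thesis
        using that ij by (auto simp: H_def algebra_simps)
    qed
    have "(H * H) $$ (i, j) = (\<Sum>k<n. H $$ (i, k) * H $$ (k, j))"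
      using H ij by (auto simp: scalar_prod_def lessThan_atLeast0)
    also have "\<dots> = (if i = j then 1 else 0) - c * (v i * conjugate (v j)) - c * (v i * conjugate (v j))
        + c * c * v i * quat_real s * conjugate (v j)"
      using ij by (simp add: entry sum.distrib sum_subtractf vv sum.delta
          flip: sum_distrib_left sum_distrib_right)
    also have "c * c * v i * quat_real s * conjugate (v j) = c * (c * quat_real s) * (v i * conjugate (v j))"
      by (metis quat_real_commute mult.assoc)
    also have "\<dots> = c * (v i * conjugate (v j)) + c * (v i * conjugate (v j))"
      unfolding c_s by (simp add: distrib_right)
    finally show "(H * H) $$ (i, j) = 1\<^sub>m n $$ (i, j)"
      using ij by simp
  qed (use H in auto)
  have "H *\<^sub>v x = y"
  proof (rule eq_vecI)
    fix i assume "i < dim_vec y"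
    then have i: "i < n" using y by auto
    have "(H *\<^sub>v x) $ i = (\<Sum>k<n. H $$ (i, k) * x $ k)"
      using H x i by (auto simp: scalar_prod_def lessThan_atLeast0)
    also have "\<dots> = (\<Sum>k<n. (if k = i then x $ i else 0) - c * v i * (conjugate (v k) * x $ k))"
      using i by (intro sum.cong) (auto simp: H_def algebra_simps)
    also have "\<dots> = x $ i - c * v i * quat_real (S - r)"
      using i by (simp add: sum_subtractf vx flip: sum_distrib_left)
    also have "c * v i * quat_real (S - r) = v i"
      by (metis c_vx quat_real_commute mult.assoc mult_1_left)
    finally show "(H *\<^sub>v x) $ i = y $ i" by (simp add: v_def)
  qed (use H y in auto)
  moreover have "quat_unitary n H"
    unfolding quat_unitary_def herm using H HH by blast
  ultimately show thesis using that herm by blast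
qed

text \<open>The image must have the norm of \<open>x\<close> and a real product with
  \<open>x\<close>. So \<open>g\<close> is the first entry of \<open>x\<close> rescaled to the norm
  of \<open>x\<close>; if that entry is 0, the product vanishes and the norm itself serves as
  \<open>g\<close>.\<close>

lemma exists_reflection_to_unit_vec:
  assumes x: "x \<in> carrier_vec n" "x \<noteq> 0\<^sub>v n" and "n > 0"
  obtains H g where "quat_unitary n H" "conj_transpose H = H" "g \<noteq> 0"
    "H *\<^sub>v x = unit_vec n 0 \<cdot>\<^sub>r g"
proof -
  define S where "S = (\<Sum>k<n. quat_normsq (x $ k))"
  have "S \<noteq> 0"
  proof
    assume "S = 0"
    then have "\<forall>k<n. x $ k = 0"
      by (simp add: S_def sum_nonneg_eq_0_iff quat_normsq_nonneg quat_normsq_eq_0_iff)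
    then show False using x by auto
  qed
  then have S: "S > 0"
    using sum_nonneg[of "{..<n}" "\<lambda>k. quat_normsq (x $ k)"] by (auto simp: S_def quat_normsq_nonneg)
  define m where "m = quat_normsq (x $ 0)"
  define g where "g = (if m = 0 then quat_real (sqrt S) else x $ 0 * quat_real (sqrt S / sqrt m))"
  have m: "m \<ge> 0" "m = 0 \<longleftrightarrow> x $ 0 = 0"
    by (auto simp: m_def quat_normsq_nonneg quat_normsq_eq_0_iff)
  have gg: "conjugate g * g = quat_real S"
  proof (cases "m = 0")
    case True
    then show ?thesis using S by (simp add: g_def flip: quat_real_mult)
  next
    case False
    have "conjugate g * g = quat_real (sqrt S / sqrt m) * ((conjugate (x $ 0) * x $ 0) * quat_real (sqrt S / sqrt m))"
      using False by (simp add: g_def conjugate_quat_mult mult.assoc)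
    also have "\<dots> = quat_real (sqrt S / sqrt m * (m * (sqrt S / sqrt m)))"
      by (simp only: conjugate_mult_self quat_real_mult m_def)
    also have "sqrt S / sqrt m * (m * (sqrt S / sqrt m)) = S"
      using S m False by (simp add: field_simps)
    finally show ?thesis .
  qed
  \<comment> \<open>For \<open>m = 0\<close> both sides are 0: on the left the first entry of
    \<open>x\<close> vanishes, on the right the factor \<open>m\<close> does.\<close>
  have xg: "conjugate (x $ 0) * g = quat_real (m * (sqrt S / sqrt m))"
  proof (cases "m = 0")
    case False
    then have "conjugate (x $ 0) * g = (conjugate (x $ 0) * x $ 0) * quat_real (sqrt S / sqrt m)"
      by (simp add: g_def mult.assoc)
    then show ?thesis by (simp only: conjugate_mult_self quat_real_mult m_def)
  qed (use m in simp)
  let ?y = "unit_vec n 0 \<cdot>\<^sub>r g"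
  have y: "?y \<in> carrier_vec n" by simp
  have yk: "?y $ k = (if k = 0 then g else 0)" if "k < n" for k using that by simp
  have "(\<Sum>k<n. conjugate (x $ k) * x $ k) = quat_real S"
    by (simp add: S_def conjugate_mult_self quat_real_sum)
  moreover have "(\<Sum>k<n. conjugate (?y $ k) * ?y $ k) = (\<Sum>k<n. if k = 0 then quat_real S else 0)"
    by (rule sum.cong) (auto simp: yk gg)
  moreover have "(\<Sum>k<n. conjugate (x $ k) * ?y $ k) =
      (\<Sum>k<n. if k = 0 then quat_real (m * (sqrt S / sqrt m)) else 0)"
    by (rule sum.cong) (use xg in \<open>auto simp: yk\<close>)
  ultimately obtain H where "quat_unitary n H" "conj_transpose H = H" "H *\<^sub>v x = ?y"
    using exists_householder[OF x(1) y] \<open>n > 0\<close> by auto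
  moreover have "g \<noteq> 0" using gg S by auto
  ultimately show thesis using that by blast
qed

lemma quat_unitary_four_block:
  assumes "conjugate a * a = 1" "quat_unitary m U"
  shows "quat_unitary (Suc m) (four_block_mat (mat 1 1 (\<lambda>_. a)) (0\<^sub>m 1 m) (0\<^sub>m m 1) U)"
proof -
  let ?a = "mat 1 1 (\<lambda>_. a)"
  have U: "U \<in> carrier_mat m m" "conj_transpose U \<in> carrier_mat m m"
    "conj_transpose U * U = 1\<^sub>m m" "U * conj_transpose U = 1\<^sub>m m"
    using assms(2) by (auto simp: quat_unitary_def)
  have "a \<noteq> 0" using assms(1) by auto
  \<comment> \<open>In a division ring a left inverse is also a right inverse.\<close>
  then have "a * conjugate a = 1"
    using assms(1) by (metis left_inverse mult.assoc mult_1_left mult_1_right right_inverse)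
  then have a: "conj_transpose ?a * ?a = 1\<^sub>m 1" "?a * conj_transpose ?a = 1\<^sub>m 1"
    using assms(1) by (auto intro!: eq_matI simp: scalar_prod_def)
  have a_carrier: "?a \<in> carrier_mat 1 1" "conj_transpose ?a \<in> carrier_mat 1 1" by auto
  have ct: "conj_transpose (four_block_mat ?a (0\<^sub>m 1 m) (0\<^sub>m m 1) U)
      = four_block_mat (conj_transpose ?a) (0\<^sub>m 1 m) (0\<^sub>m m 1) (conj_transpose U)"
    using U by (subst conj_transpose_four_block[of _ 1 1 _ m _ m]) auto
  have one: "four_block_mat (1\<^sub>m 1) (0\<^sub>m 1 m) (0\<^sub>m m 1) (1\<^sub>m m) = (1\<^sub>m (Suc m) :: quat mat)"
    using four_block_one_mat[of 1 m] by simp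
  have "four_block_mat ?a (0\<^sub>m 1 m) (0\<^sub>m m 1) U \<in> carrier_mat (1 + m) (1 + m)"
    using U by (intro four_block_carrier_mat) auto
  moreover have "four_block_mat (conj_transpose ?a) (0\<^sub>m 1 m) (0\<^sub>m m 1) (conj_transpose U)
      * four_block_mat ?a (0\<^sub>m 1 m) (0\<^sub>m m 1) U = 1\<^sub>m (Suc m)"
    using U a_carrier
    by (subst mult_four_block_mat[of _ 1 1 _ m _ m _ _ 1 _ m]) (auto simp: a one simp del: One_nat_def)
  moreover have "four_block_mat ?a (0\<^sub>m 1 m) (0\<^sub>m m 1) U
      * four_block_mat (conj_transpose ?a) (0\<^sub>m 1 m) (0\<^sub>m m 1) (conj_transpose U) = 1\<^sub>m (Suc m)"
    using U a_carrier
    by (subst mult_four_block_mat[of _ 1 1 _ m _ m _ _ 1 _ m]) (auto simp: a one simp del: One_nat_def)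
  ultimately show ?thesis unfolding quat_unitary_def ct by simp
qed

text \<open>Deflation by a reflection leaves the corner \<open>g * l * inverse g\<close>, which is
  similar to \<open>l\<close> but need not be complex. The second unitary factor therefore carries a
  unit quaternion \<open>a\<close> in its corner that turns this entry back into \<open>l\<close>,
  next to the factor supplied by induction.\<close>

lemma schur_form_exists:
  assumes "A \<in> carrier_mat n n"
  obtains U T where "schur_form A U T"
proof -
  have "\<exists>U. quat_unitary n U \<and> upper_triangular (conj_transpose U * A * U) \<and>
    (\<forall>i<n. (conj_transpose U * A * U) $$ (i, i) \<in> complex_quats \<and>
      qim1 ((conj_transpose U * A * U) $$ (i, i)) \<ge> 0)"
    using assms
  proof (induct n arbitrary: A)
    case 0
    then show ?case by (intro exI[of _ "1\<^sub>m 0"]) (auto simp: quat_unitary_one)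
  next
    case (Suc m)
    let ?n = "Suc m"
    obtain x l where x: "x \<in> carrier_vec ?n" "x \<noteq> 0\<^sub>v ?n" "A *\<^sub>v x = x \<cdot>\<^sub>r l"
      and l: "l \<in> complex_quats" "qim1 l \<ge> 0"
      using exists_right_eigenvector[OF Suc(2)] by auto
    obtain H g where H: "quat_unitary ?n H" "conj_transpose H = H"
      and g: "g \<noteq> 0" and Hx: "H *\<^sub>v x = unit_vec ?n 0 \<cdot>\<^sub>r g"
      using exists_reflection_to_unit_vec[OF x(1,2)] by auto
    have Hc: "H \<in> carrier_mat ?n ?n" and HH: "H * H = 1\<^sub>m ?n"
      using H by (auto simp: quat_unitary_def)
    define M where "M = H * A * H"
    have M: "M \<in> carrier_mat ?n ?n" using Hc Suc(2) by (simp add: M_def)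
    \<comment> \<open>The reflection is an involution, so it sends the first unit vector back to a
      right multiple of the eigenvector.\<close>
    have "H *\<^sub>v (unit_vec ?n 0 \<cdot>\<^sub>r g) = (H * H) *\<^sub>v x"
      unfolding Hx[symmetric] by (rule assoc_mult_mat_vec[OF Hc Hc x(1), symmetric])
    then have "(H *\<^sub>v unit_vec ?n 0) \<cdot>\<^sub>r g \<cdot>\<^sub>r inverse g = x \<cdot>\<^sub>r inverse g"
      using x HH by (simp add: mult_mat_vec_right_smult[OF Hc])
    then have He: "H *\<^sub>v unit_vec ?n 0 = x \<cdot>\<^sub>r inverse g"
      using g by (simp add: right_smult_vec_assoc)
    have "M *\<^sub>v unit_vec ?n 0 = H *\<^sub>v (A *\<^sub>v (H *\<^sub>v unit_vec ?n 0))"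
      unfolding M_def using Hc Suc(2) by (simp add: assoc_mult_mat_vec[of _ ?n ?n _ ?n])
    also have "\<dots> = unit_vec ?n 0 \<cdot>\<^sub>r (g * l * inverse g)"
      using Hc Suc(2) x
      by (simp add: He Hx mult_mat_vec_right_smult[of _ ?n ?n] right_smult_vec_assoc mult.assoc)
    finally have Me: "M *\<^sub>v unit_vec ?n 0 = unit_vec ?n 0 \<cdot>\<^sub>r (g * l * inverse g)" .
    \<comment> \<open>The first column of \<open>M\<close> is its value at the first unit vector,
      which is an eigenvector; hence the zero block below the corner.\<close>
    have col: "M $$ (i, 0) = (if i = 0 then g * l * inverse g else 0)" if "i < ?n" for i
    proof -
      have "M $$ (i, 0) = (M *\<^sub>v unit_vec ?n 0) $ i"
        using M that by auto
      also have "\<dots> = (if i = 0 then g * l * inverse g else 0)"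
        unfolding Me using that by auto
      finally show ?thesis .
    qed
    let ?l = "mat 1 1 (\<lambda>_. g * l * inverse g)"
    define W where "W = mat 1 m (\<lambda>(i, j). M $$ (0, Suc j))"
    define D where "D = mat m m (\<lambda>(i, j). M $$ (Suc i, Suc j))"
    have WD: "W \<in> carrier_mat 1 m" "D \<in> carrier_mat m m" by (auto simp: W_def D_def)
    have M_block: "M = four_block_mat ?l W (0\<^sub>m m 1) D"
      by (rule eq_matI) (use M col in \<open>auto simp: W_def D_def\<close>)
    obtain V where V: "quat_unitary m V" "upper_triangular (conj_transpose V * D * V)"
      "\<forall>i<m. (conj_transpose V * D * V) $$ (i, i) \<in> complex_quats \<and>
        qim1 ((conj_transpose V * D * V) $$ (i, i)) \<ge> 0"
      using Suc(1)[OF WD(2)] by blast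
    have Vc: "V \<in> carrier_mat m m" "conj_transpose V \<in> carrier_mat m m"
      using V by (auto simp: quat_unitary_def)
    define t where "t = sqrt (quat_normsq g)"
    have t: "t * t = quat_normsq g" "t \<noteq> 0"
      using g by (auto simp: t_def quat_normsq_nonneg quat_normsq_eq_0_iff)
    \<comment> \<open>The quaternion \<open>g\<close> divided by its norm \<open>t\<close>, so that
      \<open>conjugate a\<close> inverts \<open>a\<close>.\<close>
    define a where "a = g * quat_real (1 / t)"
    have ag: "conjugate a * g = quat_real t"
    proof -
      have "conjugate a * g = quat_real (1 / t) * (conjugate g * g)"
        by (simp add: a_def conjugate_quat_mult mult.assoc)
      also have "\<dots> = quat_real (1 / t * (t * t))"
        by (simp only: conjugate_mult_self quat_real_mult t(1))
      also have "1 / t * (t * t) = t" using t(2) by simp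
      finally show ?thesis .
    qed
    have aa: "conjugate a * a = 1"
    proof -
      have "conjugate a * a = conjugate a * g * quat_real (1 / t)"
        by (simp add: a_def mult.assoc)
      then show ?thesis using t by (simp add: ag flip: quat_real_mult)
    qed
    have "inverse g * a = quat_real (1 / t)"
      using g by (simp add: a_def flip: mult.assoc)
    then have "conjugate a * (g * l * inverse g) * a = quat_real t * l * quat_real (1 / t)"
      using ag by (metis mult.assoc)
    also have "\<dots> = l"
      using t by (metis quat_real_commute quat_real_mult quat_real_1 mult.assoc mult_1_right
          nonzero_eq_divide_eq mult.commute)
    finally have al: "conjugate a * (g * l * inverse g) * a = l" .
    let ?a = "mat 1 1 (\<lambda>_. a)"
    let ?P = "four_block_mat ?a (0\<^sub>m 1 m) (0\<^sub>m m 1) V"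
    have P: "quat_unitary ?n ?P" by (rule quat_unitary_four_block[OF aa V(1)])
    then have Pc: "?P \<in> carrier_mat ?n ?n" by (simp add: quat_unitary_def)
    have "conj_transpose ?P = four_block_mat (conj_transpose ?a) (0\<^sub>m 1 m) (0\<^sub>m m 1) (conj_transpose V)"
      using Vc by (subst conj_transpose_four_block[of _ 1 1 _ m _ m]) auto
    then have "conj_transpose ?P * M =
        four_block_mat (conj_transpose ?a * ?l) (conj_transpose ?a * W) (0\<^sub>m m 1) (conj_transpose V * D)"
      unfolding M_block using Vc WD
      by (simp only:) (subst mult_four_block_mat[of _ 1 1 _ m _ m _ _ 1 _ m]; auto)
    then have "conj_transpose ?P * M * ?P =
        four_block_mat (conj_transpose ?a * ?l * ?a) (conj_transpose ?a * W * V) (0\<^sub>m m 1)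
          (conj_transpose V * D * V)"
      using Vc WD
      by (simp only:) (subst mult_four_block_mat[of _ 1 1 _ m _ m _ _ 1 _ m]; auto)
    moreover have "conj_transpose ?a * ?l * ?a = mat 1 1 (\<lambda>_. l)"
      by (rule eq_matI) (use al in \<open>auto simp: scalar_prod_def\<close>)
    \<comment> \<open>Since \<open>H\<close> is self-adjoint, the two conjugations combine into one
      by \<open>H * ?P\<close>.\<close>
    moreover have "conj_transpose (H * ?P) * A * (H * ?P) = conj_transpose ?P * M * ?P"
    proof -
      have "conj_transpose (H * ?P) = conj_transpose ?P * H"
        using H Hc Pc by (simp add: conj_transpose_mult[of _ ?n ?n _ ?n])
      then show ?thesis
        unfolding M_def using Hc Pc Suc(2)
        by (simp add: assoc_mult_mat[of _ ?n ?n _ ?n _ ?n])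
    qed
    ultimately have eq: "conj_transpose (H * ?P) * A * (H * ?P) =
        four_block_mat (mat 1 1 (\<lambda>_. l)) (conj_transpose ?a * W * V) (0\<^sub>m m 1) (conj_transpose V * D * V)"
      (is "_ = ?T")
      by simp
    have "upper_triangular ?T"
      by (rule upper_triangular_four_block[where n = 1 and m = m]) (use Vc WD V in auto)
    moreover have "?T $$ (i, i) \<in> complex_quats \<and> qim1 (?T $$ (i, i)) \<ge> 0" if "i < ?n" for i
    proof (cases i)
      case 0
      then show ?thesis using l Vc by simp
    next
      case (Suc k)
      then have "?T $$ (i, i) = (conj_transpose V * D * V) $$ (k, k)"
        using that Vc by (subst index_mat_four_block) auto
      then show ?thesis using V(3) Suc that by auto
    qed
    moreover have "quat_unitary ?n (H * ?P)"
      by (rule quat_unitary_mult[OF H(1) P])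
    ultimately show ?case by (intro exI[of _ "H * ?P"]) (simp only: eq, blast)
  qed
  then obtain U where "quat_unitary n U" "upper_triangular (conj_transpose U * A * U)"
    "\<forall>i<n. (conj_transpose U * A * U) $$ (i, i) \<in> complex_quats \<and>
      qim1 ((conj_transpose U * A * U) $$ (i, i)) \<ge> 0"
    by blast
  then have "schur_form A U (conj_transpose U * A * U)"
    using assms by (auto simp: schur_form_def quat_unitary_def)
  then show thesis by (rule that)
qed

section \<open>Algebraic multiplicity under similarity\<close>

lemma schur_form_similar:
  assumes "A \<in> carrier_mat n n" "schur_form A U T"
  shows "T \<in> carrier_mat n n" "similar_mat T A"
proof -
  have U: "U \<in> carrier_mat n n" "conj_transpose U \<in> carrier_mat n n"
    "conj_transpose U * U = 1\<^sub>m n" "U * conj_transpose U = 1\<^sub>m n" "T = conj_transpose U * A * U"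
    using assms by (auto simp: schur_form_def quat_unitary_def)
  then show T: "T \<in> carrier_mat n n" using assms by simp
  show "similar_mat T A"
    by (rule similar_matI[where n = n, OF _ U(3,4,5)]) (use U T assms in auto)
qed

text \<open>Chains the similarities of \<open>T\<close> to \<open>A\<close>, of \<open>A\<close> to
  \<open>B\<close> and of \<open>B\<close> to \<open>T'\<close>. The case \<open>A = B\<close> is
  independence of the chosen Schur form.\<close>

lemma schur_form_count_eq:
  assumes A: "A \<in> carrier_mat n n" "schur_form A U T"
    and B: "B \<in> carrier_mat n n" "schur_form B U' T'"
    and "similar_mat A B"
  shows "count_list (diag_mat T) l = count_list (diag_mat T') l"
proof (rule count_diag_eq)
  show "T \<in> carrier_mat n n" "T' \<in> carrier_mat n n"
    using schur_form_similar A B by auto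
  show "similar_mat T T'"
    using schur_form_similar A B assms(5) by (meson similar_mat_sym similar_mat_trans)
qed (use A B schur_form_similar(1)[OF A] schur_form_similar(1)[OF B] in
  \<open>auto simp: schur_form_def\<close>)

text \<open>Existence of Schur forms turns any count realized for one matrix into one realized for
  the other, so the predicates under the definite description agree for every
  \<open>m\<close>.\<close>

lemma alg_mult_similar:
  assumes A: "A \<in> carrier_mat n n" and B: "B \<in> carrier_mat n n" and "similar_mat A B"
  shows "alg_mult q A = alg_mult q B"
proof -
  have "\<exists>U' T'. schur_form N U' T' \<and> m = count_list (diag_mat T') l"
    if "schur_form M U T" "m = count_list (diag_mat T) l" "similar_mat M N"
      "M \<in> carrier_mat n n" "N \<in> carrier_mat n n" for M N U T m l
    using schur_form_exists[OF that(5)] schur_form_count_eq[OF that(4,1,5) _ that(3)] that(2) by metis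
  then have "(\<exists>U T. schur_form A U T \<and> m = count_list (diag_mat T) (complex_rep q)) \<longleftrightarrow>
      (\<exists>U T. schur_form B U T \<and> m = count_list (diag_mat T) (complex_rep q))" for m
    using A B assms(3) similar_mat_sym by blast
  then show ?thesis by (simp add: alg_mult_def)
qed

section \<open>Eigenspaces of similar matrices\<close>

lemma mult_mat_vec_finsum:
  fixes Q :: "quat mat"
  assumes Q: "Q \<in> carrier_mat m n" and "finite F" and v: "v \<in> F \<rightarrow> carrier_vec n"
  shows "Q *\<^sub>v finsum_vec TYPE(quat) n v F = finsum_vec TYPE(quat) m (\<lambda>k. Q *\<^sub>v v k) F"
  using \<open>finite F\<close> v
proof (induct F)
  case empty
  then show ?case using Q by (auto simp: finsum_vec_empty)
next
  case (insert k F)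
  then have "finsum_vec TYPE(quat) n v F \<in> carrier_vec n"
    by (intro finsum_vec_closed) auto
  moreover have "finsum_vec TYPE(quat) m (\<lambda>k. Q *\<^sub>v v k) (insert k F) =
      Q *\<^sub>v v k + finsum_vec TYPE(quat) m (\<lambda>k. Q *\<^sub>v v k) F"
    by (rule finsum_vec_insert) (use insert Q in \<open>auto simp: Pi_iff\<close>)
  moreover have "finsum_vec TYPE(quat) n v (insert k F) = v k + finsum_vec TYPE(quat) n v F"
    by (rule finsum_vec_insert) (use insert in \<open>auto simp: Pi_iff\<close>)
  ultimately show ?case
    using insert Q by (simp add: mult_add_distrib_mat_vec[OF Q] Pi_iff)
qed

lemma mult_mat_vec_zero: "A \<in> carrier_mat m n \<Longrightarrow> A *\<^sub>v 0\<^sub>v n = (0\<^sub>v m :: 'a :: semiring_0 vec)"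
  by (rule eq_vecI) auto

text \<open>Here \<open>B * Q = Q * A * P * Q = Q * A\<close>, and \<open>Q\<close> commutes with
  right scaling, so the eigenvalue itself is preserved and not only its class.\<close>

lemma right_eigenspace_image:
  assumes carrier: "A \<in> carrier_mat n n" "B \<in> carrier_mat n n" "P \<in> carrier_mat n n" "Q \<in> carrier_mat n n"
    and PQ: "P * Q = 1\<^sub>m n" and B: "B = Q * A * P" and x: "x \<in> right_eigenspace A q"
  shows "Q *\<^sub>v x \<in> right_eigenspace B q"
proof -
  have xc: "x \<in> carrier_vec n" and Ax: "A *\<^sub>v x = x \<cdot>\<^sub>r q"
    using x carrier by (auto simp: right_eigenspace_def)
  have "B *\<^sub>v (Q *\<^sub>v x) = Q *\<^sub>v (A *\<^sub>v ((P * Q) *\<^sub>v x))"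
    unfolding B using carrier xc
    by (simp add: assoc_mult_mat_vec[of _ n n _ n] assoc_mult_mat[of _ n n _ n _ n])
  also have "\<dots> = (Q *\<^sub>v x) \<cdot>\<^sub>r q"
    using carrier xc PQ Ax by (simp add: mult_mat_vec_right_smult)
  finally show ?thesis using carrier xc by (simp add: right_eigenspace_def)
qed

text \<open>The map given by \<open>Q\<close> is right-linear and has the left inverse
  \<open>P\<close>, so it preserves independence, spanning and cardinality.\<close>

lemma right_basis_image:
  assumes carrier: "P \<in> carrier_mat n n" "Q \<in> carrier_mat n n" and PQ: "P * Q = 1\<^sub>m n"
    and V: "V \<subseteq> carrier_vec n" and W: "right_basis n V W"
  shows "right_basis n ((*\<^sub>v) Q ` V) ((*\<^sub>v) Q ` W) \<and> card ((*\<^sub>v) Q ` W) = card W"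
proof -
  have WV: "finite W" "W \<subseteq> V" "W \<subseteq> carrier_vec n" using W V by (auto simp: right_basis_def)
  have inv: "P *\<^sub>v (Q *\<^sub>v x) = x" if "x \<in> carrier_vec n" for x
    using carrier PQ that by (simp flip: assoc_mult_mat_vec)
  have inj: "inj_on ((*\<^sub>v) Q) W"
    by (rule inj_on_inverseI[where g = "(*\<^sub>v) P"]) (use inv WV in auto)
  \<comment> \<open>Coefficients are functions of the basis vectors, so those on the image are
    pulled back along \<open>Q\<close>.\<close>
  have lin: "right_lincomb n c ((*\<^sub>v) Q ` W) = Q *\<^sub>v right_lincomb n (\<lambda>w. c (Q *\<^sub>v w)) W" for c
  proof -
    have "right_lincomb n c ((*\<^sub>v) Q ` W) = finsum_vec TYPE(quat) n (\<lambda>w. Q *\<^sub>v w \<cdot>\<^sub>r c (Q *\<^sub>v w)) W"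
      unfolding right_lincomb_def finsum_vec_def
      by (rule comm_monoid.finprod_reindex[OF comm_monoid_vec])
        (use WV carrier inj in \<open>auto simp: monoid_vec_simps\<close>)
    also have "\<dots> = finsum_vec TYPE(quat) n (\<lambda>w. Q *\<^sub>v (w \<cdot>\<^sub>r c (Q *\<^sub>v w))) W"
      unfolding finsum_vec_def
      by (rule comm_monoid.finprod_cong'[OF comm_monoid_vec])
        (use WV carrier in \<open>auto simp: monoid_vec_simps mult_mat_vec_right_smult subset_iff\<close>)
    also have "\<dots> = Q *\<^sub>v right_lincomb n (\<lambda>w. c (Q *\<^sub>v w)) W"
      unfolding right_lincomb_def
      by (rule mult_mat_vec_finsum[symmetric]) (use WV carrier in auto)
    finally show ?thesis .
  qed
  have closed: "right_lincomb n c W \<in> carrier_vec n" for c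
    unfolding right_lincomb_def by (rule finsum_vec_closed) (use WV in auto)
  have "c w = 0" if "right_lincomb n c ((*\<^sub>v) Q ` W) = 0\<^sub>v n" "w \<in> (*\<^sub>v) Q ` W" for c w
  proof -
    have "P *\<^sub>v (Q *\<^sub>v right_lincomb n (\<lambda>w. c (Q *\<^sub>v w)) W) = P *\<^sub>v 0\<^sub>v n"
      using that(1) by (simp add: lin)
    then have "right_lincomb n (\<lambda>w. c (Q *\<^sub>v w)) W = 0\<^sub>v n"
      using carrier by (simp add: inv closed mult_mat_vec_zero)
    then have "\<forall>w\<in>W. c (Q *\<^sub>v w) = 0"
      using W unfolding right_basis_def by blast
    then show ?thesis using that(2) by auto
  qed
  moreover have "\<exists>c. Q *\<^sub>v v = right_lincomb n c ((*\<^sub>v) Q ` W)" if "v \<in> V" for v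
  proof -
    obtain c where c: "v = right_lincomb n c W"
      using W \<open>v \<in> V\<close> unfolding right_basis_def by blast
    \<comment> \<open>Coefficients on the image are read off through \<open>P\<close>, which undoes
      \<open>Q\<close> on \<open>W\<close>.\<close>
    have "right_lincomb n (\<lambda>w. c (P *\<^sub>v (Q *\<^sub>v w))) W = right_lincomb n c W"
      unfolding right_lincomb_def finsum_vec_def
      by (rule comm_monoid.finprod_cong'[OF comm_monoid_vec])
        (use WV inv in \<open>auto simp: monoid_vec_simps subset_iff\<close>)
    then have "Q *\<^sub>v v = right_lincomb n (\<lambda>w. c (P *\<^sub>v w)) ((*\<^sub>v) Q ` W)"
      by (simp add: lin c)
    then show ?thesis by blast
  qed
  ultimately show ?thesis
    using WV inj unfolding right_basis_def by (auto simp: card_image)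
qed

lemma class_eigenspace_subset:
  assumes "A \<in> carrier_mat n n"
  shows "class_eigenspace A q \<subseteq> carrier_vec n"
  using assms
  by (auto simp: class_eigenspace_def right_eigenspace_def intro!: finsum_vec_closed)

text \<open>\<open>Q\<close> passes through the finite sum and keeps the eigenvalue of each summand,
  hence its class.\<close>

lemma class_eigenspace_image:
  assumes carrier: "A \<in> carrier_mat n n" "B \<in> carrier_mat n n" "P \<in> carrier_mat n n" "Q \<in> carrier_mat n n"
    and PQ: "P * Q = 1\<^sub>m n" and B: "B = Q * A * P"
  shows "(*\<^sub>v) Q ` class_eigenspace A q \<subseteq> class_eigenspace B q"
proof
  fix y assume "y \<in> (*\<^sub>v) Q ` class_eigenspace A q"
  then obtain m v where y: "y = Q *\<^sub>v finsum_vec TYPE(quat) n v {..<m :: nat}"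
    and v: "\<forall>k<m. \<exists>p\<in>similarity_class q. v k \<in> right_eigenspace A p"
    using carrier by (auto simp: class_eigenspace_def)
  have "y = finsum_vec TYPE(quat) n (\<lambda>k. Q *\<^sub>v v k) {..<m}"
    unfolding y by (rule mult_mat_vec_finsum) (use carrier v in \<open>auto simp: right_eigenspace_def\<close>)
  moreover have "\<forall>k<m. \<exists>p\<in>similarity_class q. Q *\<^sub>v v k \<in> right_eigenspace B p"
    using right_eigenspace_image[OF carrier PQ B] v by blast
  ultimately show "y \<in> class_eigenspace B q"
    using carrier by (auto simp: class_eigenspace_def)
qed

lemma class_eigenspace_image_eq:
  assumes carrier: "A \<in> carrier_mat n n" "B \<in> carrier_mat n n" "P \<in> carrier_mat n n" "Q \<in> carrier_mat n n"
    and PQ: "P * Q = 1\<^sub>m n" "Q * P = 1\<^sub>m n" and A: "A = P * B * Q" and B: "B = Q * A * P"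
  shows "(*\<^sub>v) Q ` class_eigenspace A q = class_eigenspace B q"
proof
  show "(*\<^sub>v) Q ` class_eigenspace A q \<subseteq> class_eigenspace B q"
    by (rule class_eigenspace_image[OF carrier PQ(1) B])
  show "class_eigenspace B q \<subseteq> (*\<^sub>v) Q ` class_eigenspace A q"
  proof
    fix y assume y: "y \<in> class_eigenspace B q"
    then have "P *\<^sub>v y \<in> class_eigenspace A q"
      using class_eigenspace_image[OF carrier(2,1,4,3) PQ(2) A] by auto
    moreover have "y \<in> carrier_vec n"
      using y class_eigenspace_subset[OF carrier(2)] by auto
    then have "y = Q *\<^sub>v (P *\<^sub>v y)"
      using carrier PQ by (simp flip: assoc_mult_mat_vec)
    ultimately show "y \<in> (*\<^sub>v) Q ` class_eigenspace A q" by blast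
  qed
qed

section \<open>Equality of spectra and of geometric multiplicities\<close>

lemma right_eigenvalue_iff:
  "right_eigenvalue A q \<longleftrightarrow> (\<exists>x\<in>right_eigenspace A q. x \<noteq> 0\<^sub>v (dim_row A))"
  by (auto simp: right_eigenvalue_def right_eigenspace_def)

lemma right_eigenvalue_similar:
  assumes carrier: "A \<in> carrier_mat n n" "B \<in> carrier_mat n n" and "similar_mat A B"
    and q: "right_eigenvalue A q"
  shows "right_eigenvalue B q"
proof -
  obtain Q P where "similar_mat_wit B A Q P"
    using similar_mat_sym[OF assms(3)] by (auto simp: similar_mat_def)
  note wit = similar_mat_witD2[OF carrier(2) this]
  obtain x where x: "x \<in> right_eigenspace A q" "x \<noteq> 0\<^sub>v n"
    using q carrier by (auto simp: right_eigenvalue_iff)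
  then have xc: "x \<in> carrier_vec n" using carrier by (auto simp: right_eigenspace_def)
  \<comment> \<open>The left inverse \<open>P\<close> keeps a nonzero eigenvector from being sent to
    zero.\<close>
  have "Q *\<^sub>v x \<noteq> 0\<^sub>v n"
  proof
    assume "Q *\<^sub>v x = 0\<^sub>v n"
    moreover have "P *\<^sub>v (Q *\<^sub>v x) = x" using wit xc by (simp flip: assoc_mult_mat_vec)
    ultimately show False using x wit by (simp add: mult_mat_vec_zero)
  qed
  moreover have "Q *\<^sub>v x \<in> right_eigenspace B q"
    by (rule right_eigenspace_image[OF wit(5,4,7,6,2,3) x(1)])
  ultimately show ?thesis using carrier by (auto simp: right_eigenvalue_iff)
qed

text \<open>Images of bases are bases of the same size, so the predicates under the definite description
  agree and the uniqueness of the dimension is not needed.\<close>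

lemma geom_mult_similar:
  assumes carrier: "A \<in> carrier_mat n n" "B \<in> carrier_mat n n" and "similar_mat A B"
  shows "geom_mult q A = geom_mult q B"
proof -
  \<comment> \<open>Stated for arbitrary \<open>M\<close> and \<open>N\<close>, so that it serves
    both directions of the equivalence.\<close>
  have bases: "\<exists>W'. right_basis n (class_eigenspace N q) W' \<and> card W' = card W"
    if sim: "similar_mat M N" and M: "M \<in> carrier_mat n n" and N: "N \<in> carrier_mat n n"
      and W: "right_basis n (class_eigenspace M q) W" for M N W
  proof -
    obtain P Q where wit': "similar_mat_wit M N P Q"
      using sim by (auto simp: similar_mat_def)
    note wit = similar_mat_witD2[OF M wit']
    have "N = Q * M * P" by (rule similar_mat_witD2(3)[OF N similar_mat_wit_sym[OF wit']])
    then have "(*\<^sub>v) Q ` class_eigenspace M q = class_eigenspace N q"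
      by (rule class_eigenspace_image_eq[OF M N wit(6,7,1,2,3)])
    then show ?thesis
      using right_basis_image[OF wit(6,7,1) class_eigenspace_subset[OF M] W] by metis
  qed
  have "(\<exists>W. right_basis n (class_eigenspace A q) W \<and> d = card W) \<longleftrightarrow>
      (\<exists>W. right_basis n (class_eigenspace B q) W \<and> d = card W)" for d
    using bases[OF assms(3) carrier] bases[OF similar_mat_sym[OF assms(3)] carrier(2,1)] by metis
  then show ?thesis using carrier by (simp add: geom_mult_def right_dim_def)
qed

theorem proposition2p4:
  fixes A B :: "quat mat" and n :: nat
  assumes "A \<in> carrier_mat n n" and "B \<in> carrier_mat n n"
    and "similar_mat B A"
  shows "right_spectrum A = right_spectrum B \<and>
    (\<forall>q \<in> right_spectrum A \<inter> right_spectrum B.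
      alg_mult q A = alg_mult q B \<and> geom_mult q A = geom_mult q B)"
proof -
  note AB = similar_mat_sym[OF assms(3)]
  have "right_spectrum A = right_spectrum B"
    using right_eigenvalue_similar[OF assms(1,2) AB] right_eigenvalue_similar[OF assms(2,1,3)]
    by (auto simp: right_spectrum_def)
  then show ?thesis
    using alg_mult_similar[OF assms(1,2) AB] geom_mult_similar[OF assms(1,2) AB] by blast
qed

end
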